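(* Let $\lambda,\mu,\theta>0$ and let $m\ge 1$ be an integer. For $\mathrm{X}\in\{\mathrm{DBS},\mathrm{DES}\}$ let $M^{\mathrm{X},\mu}(\lambda)$, $P_{\mathrm{ab}}^{\mathrm{X},\mu}(\lambda)$ and $\ell^{\mathrm{X},\mu}(\lambda)$ denote, respectively, the steady-state mean number of busy servers, the abandonment probability, and the mean abandonment rate in an M/M/$m+$M queue with arrival rate $\lambda$, server rate $\mu$ and abandonment rate $\theta$ under deadline type $\mathrm{X}$. Then: (a) $M^{\mathrm{DES},\mu}(\lambda)=M^{\mathrm{DBS},\mu+\theta}(\lambda)$; (b) $(\mu+\theta)\big(1-P_{\mathrm{ab}}^{\mathrm{DES},\mu}(\lambda)\big)=\mu\big(1-P_{\mathrm{ab}}^{\mathrm{DBS},\mu+\theta}(\lambda)\big)$; (c) $(\mu+\theta)\,\ell^{\mathrm{DES},\mu}(\lambda)=\lambda\theta+\mu\,\ell^{\mathrm{DBS},\mu+\theta}(\lambda)$.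
   Context: M/M/$m+$M queue: jobs arrive as a Poisson process of rate $\lambda$ to a node with $m$ identical servers, an unlimited buffer, FCFS scheduling, and independent exponential service times of rate $\mu$; each job has an independent exponential relative deadline (time from arrival to deadline expiration) with rate $\theta$, and abandons the system immediately upon missing it. Under DBS (deadline to the beginning of service) a job abandons if its deadline expires before its service starts; under DES (deadline to the end of service) it abandons if its deadline expires before its service ends. Thus the number of jobs in system is a birth-death process on $\{0,1,2,\ldots\}$ with birth rate $\lambda$ and death rate $\min(i,m)\mu+L(i)$ in state $i$, where the total abandonment rate is $L(i)=(i-m)^+\theta$ under DBS and $L(i)=i\theta$ under DES, with $x^+=\max(x,0)$. With $p_i$ the steady-state probabilities, the mean number of busy servers is $\sum_{i\ge 0}\min(i,m)p_i$; the mean abandonment rate is $\ell=\sum_{i\ge 0}L(i)p_i=\lambda P_{\mathrm{ab}}$, where $P_{\mathrm{ab}}$ is the probability that a random arrival abandons. The superscript $\mu+\theta$ refers to the same queue with server rate $\mu$ replaced by $\mu+\theta$ ($m$ and $\theta$ unchanged). *)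

theory Defs
  imports "HOL-Probability.Probability"
begin

text \<open>
  The arrival rate is called \<open>lam\<close>; \<open>\<mu>\<close> is the rate of each of the \<open>m\<close> servers and \<open>\<theta>\<close> the rate of
  the exponential relative deadlines.
\<close>

datatype deadline_type = DBS | DES

fun abandonment_rate :: "deadline_type \<Rightarrow> nat \<Rightarrow> real \<Rightarrow> nat \<Rightarrow> real" where
  "abandonment_rate DBS m \<theta> i = max (real i - real m) 0 * \<theta>"
| "abandonment_rate DES m \<theta> i = real i * \<theta>"

definition death_rate :: "deadline_type \<Rightarrow> nat \<Rightarrow> real \<Rightarrow> real \<Rightarrow> nat \<Rightarrow> real" where
  "death_rate X m \<mu> \<theta> i = real (min i m) * \<mu> + abandonment_rate X m \<theta> i"

text \<open>
  The transition rate matrix of a birth-death process on the natural numbers with constant birth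
  rate \<open>lam\<close> and death rates \<open>d\<close>, where \<open>d 0 = 0\<close>.
\<close>

definition birth_death_generator :: "real \<Rightarrow> (nat \<Rightarrow> real) \<Rightarrow> nat \<Rightarrow> nat \<Rightarrow> real" where
  "birth_death_generator lam d i j =
     (if j = Suc i then lam
      else if i = Suc j then d i
      else if i = j then - (lam + d i)
      else 0)"

text \<open>Global balance: the row vector \<open>p\<close> annihilates the generator \<open>Q\<close>.\<close>

definition stationary :: "(nat \<Rightarrow> nat \<Rightarrow> real) \<Rightarrow> nat pmf \<Rightarrow> bool" where
  "stationary Q p \<longleftrightarrow> (\<forall>j. ((\<lambda>i. pmf p i * Q i j) has_sum 0) UNIV)"

definition steady_state :: "deadline_type \<Rightarrow> nat \<Rightarrow> real \<Rightarrow> real \<Rightarrow> real \<Rightarrow> nat pmf" where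
  "steady_state X m \<mu> \<theta> lam =
     (THE p. stationary (birth_death_generator lam (death_rate X m \<mu> \<theta>)) p)"

definition mean_busy_servers :: "deadline_type \<Rightarrow> nat \<Rightarrow> real \<Rightarrow> real \<Rightarrow> real \<Rightarrow> real" where
  "mean_busy_servers X m \<mu> \<theta> lam =
     (\<Sum>i. real (min i m) * pmf (steady_state X m \<mu> \<theta> lam) i)"

definition mean_abandonment_rate :: "deadline_type \<Rightarrow> nat \<Rightarrow> real \<Rightarrow> real \<Rightarrow> real \<Rightarrow> real" where
  "mean_abandonment_rate X m \<mu> \<theta> lam =
     (\<Sum>i. abandonment_rate X m \<theta> i * pmf (steady_state X m \<mu> \<theta> lam) i)"

definition exponential_measure :: "real \<Rightarrow> real measure" where
  "exponential_measure r = density lborel (\<lambda>x. ennreal (exponential_density r x))"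

text \<open>
  The randomness that decides the fate of a job finding \<open>i\<close> jobs in the system on arrival: a triple
  \<open>(t, s, e)\<close> of its relative deadline, its service time, and the times \<open>e j\<close> during which exactly
  \<open>j\<close> of the jobs found are still present, for \<open>m \<le> j \<le> i\<close>. Under FCFS the later arrivals are
  irrelevant and service starts as soon as fewer than \<open>m\<close> of the jobs found are left (at once if
  \<open>i < m\<close>). By memorylessness the \<open>e j\<close> are independent and exponential, with rate the total
  departure rate of \<open>j\<close> jobs.
\<close>

definition arrival_space ::
    "deadline_type \<Rightarrow> nat \<Rightarrow> real \<Rightarrow> real \<Rightarrow> nat \<Rightarrow> (real \<times> real \<times> (nat \<Rightarrow> real)) measure" where
  "arrival_space X m \<mu> \<theta> i =
     exponential_measure \<theta> \<Otimes>\<^sub>M exponential_measure \<mu> \<Otimes>\<^sub>M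
       (\<Pi>\<^sub>M j\<in>{m..i}. exponential_measure (death_rate X m \<mu> \<theta> j))"

definition offered_wait :: "nat \<Rightarrow> nat \<Rightarrow> (nat \<Rightarrow> real) \<Rightarrow> real" where
  "offered_wait m i e = (\<Sum>j=m..i. e j)"

fun abandons :: "deadline_type \<Rightarrow> real \<Rightarrow> real \<Rightarrow> real \<Rightarrow> bool" where
  "abandons DBS t s w \<longleftrightarrow> t < w"
| "abandons DES t s w \<longleftrightarrow> t < w + s"

definition abandonment_prob_given :: "deadline_type \<Rightarrow> nat \<Rightarrow> real \<Rightarrow> real \<Rightarrow> nat \<Rightarrow> real" where
  "abandonment_prob_given X m \<mu> \<theta> i =
     \<P>((t, s, e) in arrival_space X m \<mu> \<theta> i. abandons X t s (offered_wait m i e))"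

text \<open>Poisson arrivals see the steady-state distribution.\<close>

definition abandonment_prob :: "deadline_type \<Rightarrow> nat \<Rightarrow> real \<Rightarrow> real \<Rightarrow> real \<Rightarrow> real" where
  "abandonment_prob X m \<mu> \<theta> lam =
     (\<Sum>i. pmf (steady_state X m \<mu> \<theta> lam) i * abandonment_prob_given X m \<mu> \<theta> i)"

end

theory Submission
  imports Defs
begin

text \<open>
  Both systems have the same death rates, since \<open>min i m (\<mu> + \<theta>) + max (i - m) 0 \<theta> = min i m \<mu> + i \<theta>\<close>,
  and hence the same steady state; this gives (a). For (c), multiply the flow conservation
  \<open>lam = (\<Sum>i. death_rate i p i)\<close> by \<open>\<theta>\<close>. For (b), the deadline is exponential, so a job that meets a
  queue with offered wait \<open>w\<close> is served with probability \<open>E exp (- \<theta> w)\<close> under DBS and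
  \<open>E exp (- \<theta> (w + s))\<close> under DES; the service time \<open>s\<close> is independent of \<open>w\<close>, which contributes the
  factor \<open>E exp (- \<theta> s) = \<mu> / (\<mu> + \<theta>)\<close>.
\<close>

subsection \<open>Steady state of a birth-death process\<close>

lemma sums_pmf_nat: "pmf (p :: nat pmf) sums 1"
proof -
  have "(\<lambda>i. measure (measure_pmf p) {i}) sums measure (measure_pmf p) (\<Union>i. {i})"
    by (rule measure_pmf.finite_measure_UNION) (auto simp: disjoint_family_on_def)
  moreover have "(\<Union>i::nat. {i}) = UNIV" by auto
  ultimately show ?thesis by (simp add: pmf.rep_eq)
qed

text \<open>Each balance equation is a difference of net flows across two adjacent cuts, and no flow
  crosses below state 0 because \<open>d 0 = 0\<close>. By induction from 0 the net flow vanishes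
  across every cut.\<close>

lemma stationary_iff_local_balance:
  fixes d :: "nat \<Rightarrow> real"
  assumes d0: "d 0 = 0"
  shows "stationary (birth_death_generator lam d) p \<longleftrightarrow>
           (\<forall>n. lam * pmf p n = d (Suc n) * pmf p (Suc n))"
proof -
  let ?Q = "birth_death_generator lam d"
  \<comment> \<open>Column \<open>j\<close> is supported on the neighbours of \<open>j\<close>, so
    the infinite sum is finite. For \<open>j = 0\<close> truncated subtraction turns the window into
    \<open>{0..1}\<close>.\<close>
  have col: "((\<lambda>i. pmf p i * ?Q i j) has_sum x) UNIV \<longleftrightarrow> (\<Sum>i\<in>{j - 1..Suc j}. pmf p i * ?Q i j) = x"
    for j x
  proof -
    have "((\<lambda>i. pmf p i * ?Q i j) has_sum x) UNIV \<longleftrightarrow>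
          ((\<lambda>i. pmf p i * ?Q i j) has_sum x) {j - 1..Suc j}"
      by (rule has_sum_cong_neutral) (auto simp: birth_death_generator_def)
    also have "\<dots> \<longleftrightarrow> (\<Sum>i\<in>{j - 1..Suc j}. pmf p i * ?Q i j) = x"
      by (simp add: has_sum_finite_iff eq_commute)
    finally show ?thesis .
  qed
  have sum0: "(\<Sum>i\<in>{0 - 1..Suc 0}. pmf p i * ?Q i 0) = d 1 * pmf p 1 - lam * pmf p 0"
    by (simp add: birth_death_generator_def d0)
  \<comment> \<open>Net flow across the cut above \<open>Suc k\<close> minus that across the cut
    below it; the induction hypothesis kills the latter.\<close>
  have sumS: "(\<Sum>i\<in>{Suc k - 1..Suc (Suc k)}. pmf p i * ?Q i (Suc k)) =
      (d (Suc (Suc k)) * pmf p (Suc (Suc k)) - lam * pmf p (Suc k)) -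
      (d (Suc k) * pmf p (Suc k) - lam * pmf p k)" for k
    by (simp add: birth_death_generator_def algebra_simps)
  have "stationary ?Q p \<longleftrightarrow> (\<forall>j. (\<Sum>i\<in>{j - 1..Suc j}. pmf p i * ?Q i j) = 0)"
    by (simp only: stationary_def col)
  also have "\<dots> \<longleftrightarrow> (\<forall>n. lam * pmf p n = d (Suc n) * pmf p (Suc n))"
  proof
    assume H: "\<forall>j. (\<Sum>i\<in>{j - 1..Suc j}. pmf p i * ?Q i j) = 0"
    have "lam * pmf p n = d (Suc n) * pmf p (Suc n)" for n
    proof (induction n)
      case 0
      then show ?case using H[rule_format, of 0] unfolding sum0 by simp
    next
      case (Suc n)
      then show ?case using H[rule_format, of "Suc n"] unfolding sumS by simp
    qed
    then show "\<forall>n. lam * pmf p n = d (Suc n) * pmf p (Suc n)" by blast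
  next
    assume H: "\<forall>n. lam * pmf p n = d (Suc n) * pmf p (Suc n)"
    have "(\<Sum>i\<in>{j - 1..Suc j}. pmf p i * ?Q i j) = 0" for j
    proof (cases j)
      case 0
      then show ?thesis using H[rule_format, of 0] sum0 by simp
    next
      case (Suc k)
      then show ?thesis using H[rule_format, of k] H[rule_format, of "Suc k"] sumS[of k] by simp
    qed
    then show "\<forall>j. (\<Sum>i\<in>{j - 1..Suc j}. pmf p i * ?Q i j) = 0" by blast
  qed
  finally show ?thesis .
qed

text \<open>Local balance is a first-order recursion, so a solution is determined by its value at 0,
  and total mass 1 fixes that value. Unique existence is what gives meaning to the
  \<open>THE\<close> in \<open>steady_state\<close>.\<close>

lemma ex1_stationary:
  fixes lam :: real and d :: "nat \<Rightarrow> real"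
  assumes lam: "lam > 0" and th: "\<theta> > 0" and d0: "d 0 = 0"
    and d_ge: "\<And>n. real n * \<theta> \<le> d n"
  shows "\<exists>!p. stationary (birth_death_generator lam d) p"
proof -
  \<comment> \<open>The unnormalised solution of local balance with \<open>a 0 = 1\<close>.\<close>
  define a where "a n = (\<Prod>k<n. lam / d (Suc k))" for n
  have d_pos: "d (Suc n) > 0" for n
    by (rule less_le_trans[OF _ d_ge]) (use th in simp)
  have a_pos: "a n > 0" for n
    unfolding a_def by (intro prod_pos) (use lam d_pos in auto)
  have a_Suc: "d (Suc n) * a (Suc n) = lam * a n" for n
    using d_pos[of n] by (simp add: a_def)
  \<comment> \<open>Comparison with the infinite-server rates \<open>real n * \<theta>\<close>
    bounds the weights by the terms of the series of \<open>exp (lam / \<theta>)\<close>, so they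
    can be normalised.\<close>
  have a_le: "a n \<le> (lam / \<theta>) ^ n / fact n" for n
  proof (induction n)
    case 0
    show ?case by (simp add: a_def)
  next
    case (Suc n)
    have "a (Suc n) = a n * (lam / d (Suc n))" by (simp add: a_def)
    also have "\<dots> \<le> ((lam / \<theta>) ^ n / fact n) * (lam / (real (Suc n) * \<theta>))"
      using Suc d_ge[of "Suc n"] d_pos[of n] th lam a_pos[of n]
      by (intro mult_mono divide_left_mono mult_pos_pos) (auto simp: less_imp_le)
    also have "\<dots> = (lam / \<theta>) ^ Suc n / fact (Suc n)"
      by (simp add: field_simps)
    finally show ?case .
  qed
  have summ: "summable a"
  proof (rule summable_comparison_test')
    show "summable (\<lambda>n. (lam / \<theta>) ^ n / fact n)"
      using summable_exp_generic[of "lam / \<theta>"] by (simp add: field_simps)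
    show "norm (a n) \<le> (lam / \<theta>) ^ n / fact n" if "n \<ge> 0" for n
      using a_le[of n] a_pos[of n] by simp
  qed
  define S where "S = suminf a"
  have S_pos: "S > 0" unfolding S_def using summ a_pos by (rule suminf_pos)
  define p where "p = embed_pmf (\<lambda>n. a n / S)"
  have "(\<lambda>n. a n / S) sums (S / S)"
    unfolding S_def using summ by (intro sums_divide summable_sums)
  then have "(\<Sum>n. ennreal (a n / S)) = ennreal 1"
    using S_pos a_pos by (intro suminf_ennreal_eq) (auto simp: less_imp_le)
  then have pmf_p: "pmf p n = a n / S" for n
    unfolding p_def using S_pos a_pos
    by (intro pmf_embed_pmf) (auto simp: nn_integral_count_space_nat less_imp_le)
  have "stationary (birth_death_generator lam d) p"
    unfolding stationary_iff_local_balance[of d, OF d0] pmf_p using a_Suc by (metis times_divide_eq_right)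
  \<comment> \<open>Any stationary \<open>q\<close> is a multiple of \<open>a\<close>; its total
    mass forces \<open>pmf q 0 = 1 / S\<close>.\<close>
  moreover have "q = p" if "stationary (birth_death_generator lam d) q" for q
  proof -
    have bal: "lam * pmf q n = d (Suc n) * pmf q (Suc n)" for n
      using that stationary_iff_local_balance[of d, OF d0] by blast
    have q: "pmf q n = pmf q 0 * a n" for n
    proof (induction n)
      case 0
      show ?case by (simp add: a_def)
    next
      case (Suc n)
      have "d (Suc n) * pmf q (Suc n) = d (Suc n) * (pmf q 0 * a (Suc n))"
        using bal[of n] Suc a_Suc[of n] by (simp add: algebra_simps)
      then show ?case using d_pos[of n] by simp
    qed
    have "(\<lambda>n. pmf q 0 * a n) sums (pmf q 0 * S)"
      unfolding S_def using summ by (intro sums_mult summable_sums)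
    then have "pmf q 0 * S = 1"
      using sums_pmf_nat[of q] sums_unique2 by (simp add: q[symmetric])
    then have "pmf q 0 = 1 / S" using S_pos by (simp add: field_simps)
    then have "pmf q n = pmf p n" for n by (subst q) (simp add: pmf_p)
    then show "q = p" by (rule pmf_eqI)
  qed
  ultimately show ?thesis by blast
qed

section \<open>Common death rates and flow conservation\<close>

lemma death_rate_0: "death_rate X m \<mu> \<theta> 0 = 0"
  by (cases X) (auto simp: death_rate_def)

lemma death_rate_DES: "death_rate DES m \<mu> \<theta> i = real (min i m) * \<mu> + real i * \<theta>"
  by (simp add: death_rate_def)

text \<open>Under DES a job in service leaves at rate \<mu> + \<theta>, by completion or by expiry;
  under DBS with faster servers it leaves at the same rate by completion alone. Waiting jobs leave
  at rate \<theta> in both.\<close>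

lemma death_rate_DBS: "death_rate DBS m (\<mu> + \<theta>) \<theta> = death_rate DES m \<mu> \<theta>"
proof
  fix i
  show "death_rate DBS m (\<mu> + \<theta>) \<theta> i = death_rate DES m \<mu> \<theta> i"
    by (cases "i \<le> m") (simp_all add: death_rate_def algebra_simps)
qed

lemma steady_state_DBS: "steady_state DBS m (\<mu> + \<theta>) \<theta> lam = steady_state DES m \<mu> \<theta> lam"
  by (simp add: steady_state_def death_rate_DBS)

text \<open>Summing local balance over all states gives \<open>lam\<close> on the left, and on the
  right every departure term except that of state 0, which is zero.\<close>

lemma sums_departure_rate:
  assumes lam: "lam > 0" and mu: "\<mu> > 0" and th: "\<theta> > 0"
  shows "(\<lambda>i. death_rate DES m \<mu> \<theta> i * pmf (steady_state DES m \<mu> \<theta> lam) i) sums lam"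
proof -
  let ?d = "death_rate DES m \<mu> \<theta>"
  let ?p = "steady_state DES m \<mu> \<theta> lam"
  have "stationary (birth_death_generator lam ?d) ?p"
    unfolding steady_state_def
  proof (rule theI'[OF ex1_stationary])
    show "real n * \<theta> \<le> ?d n" for n using mu by (simp add: death_rate_DES)
  qed (use lam th in \<open>simp_all add: death_rate_0\<close>)
  then have bal: "lam * pmf ?p n = ?d (Suc n) * pmf ?p (Suc n)" for n
    by (simp add: stationary_iff_local_balance death_rate_0)
  have "(\<lambda>n. lam * pmf ?p n) sums (lam * 1)"
    by (intro sums_mult sums_pmf_nat)
  then have "(\<lambda>n. ?d (Suc n) * pmf ?p (Suc n)) sums lam" by (simp add: bal)
  then show ?thesis by (subst (asm) sums_Suc_iff) (simp add: death_rate_0)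
qed

lemma abandonment_rate_conservation:
  assumes lam: "lam > 0" and mu: "\<mu> > 0" and th: "\<theta> > 0"
  shows "(\<mu> + \<theta>) * mean_abandonment_rate DES m \<mu> \<theta> lam
           = lam * \<theta> + \<mu> * mean_abandonment_rate DBS m (\<mu> + \<theta>) \<theta> lam"
proof -
  let ?p = "steady_state DES m \<mu> \<theta> lam"
  note flow = sums_departure_rate[OF assms, of m]
  \<comment> \<open>Both abandonment rates are at most \<open>real i * \<theta>\<close>, hence at
    most the death rate, whose mean is finite by flow conservation.\<close>
  have summ: "summable (\<lambda>i. abandonment_rate X m \<theta> i * pmf ?p i)" for X
  proof (rule summable_comparison_test')
    show "norm (abandonment_rate X m \<theta> i * pmf ?p i) \<le> death_rate DES m \<mu> \<theta> i * pmf ?p i"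
      if "i \<ge> 0" for i
    proof -
      have "0 \<le> abandonment_rate X m \<theta> i" using th by (cases X) simp_all
      moreover have "abandonment_rate X m \<theta> i \<le> real i * \<theta>"
        using th by (cases X) simp_all
      moreover have "real i * \<theta> \<le> death_rate DES m \<mu> \<theta> i"
        using mu by (simp add: death_rate_DES)
      ultimately show ?thesis by (simp add: abs_mult mult_right_mono)
    qed
  qed (rule sums_summable[OF flow])
  have "(\<lambda>i. \<theta> * (death_rate DES m \<mu> \<theta> i * pmf ?p i)
          + \<mu> * (abandonment_rate DBS m \<theta> i * pmf ?p i))
        sums (\<theta> * lam + \<mu> * (\<Sum>i. abandonment_rate DBS m \<theta> i * pmf ?p i))"
    by (intro sums_add sums_mult flow summable_sums summ)
  moreover have "(\<lambda>i. (\<mu> + \<theta>) * (abandonment_rate DES m \<theta> i * pmf ?p i))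
        sums ((\<mu> + \<theta>) * (\<Sum>i. abandonment_rate DES m \<theta> i * pmf ?p i))"
    by (intro sums_mult summable_sums summ)
  \<comment> \<open>The waiting jobs and the busy servers add up to \<open>i\<close>, so the two
    terms carrying the factor \<mu> combine to \<open>\<mu> * i * \<theta>\<close>.\<close>
  moreover have "\<theta> * (death_rate DES m \<mu> \<theta> i * pmf ?p i)
          + \<mu> * (abandonment_rate DBS m \<theta> i * pmf ?p i)
      = (\<mu> + \<theta>) * (abandonment_rate DES m \<theta> i * pmf ?p i)" for i
    by (cases "i \<le> m") (simp_all add: death_rate_DES algebra_simps)
  ultimately have "(\<mu> + \<theta>) * (\<Sum>i. abandonment_rate DES m \<theta> i * pmf ?p i)
      = \<theta> * lam + \<mu> * (\<Sum>i. abandonment_rate DBS m \<theta> i * pmf ?p i)"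
    by (simp only: sums_unique2)
  then show ?thesis
    by (simp only: mean_abandonment_rate_def steady_state_DBS mult.commute[of lam])
qed

subsection \<open>Abandonment probability of an arriving job\<close>

lemma sets_exponential_measure [simp, measurable_cong]: "sets (exponential_measure r) = sets borel"
  by (simp add: exponential_measure_def)

lemma space_exponential_measure [simp]: "space (exponential_measure r) = UNIV"
  by (simp add: exponential_measure_def)

lemma prob_space_exponential_measure: "r > 0 \<Longrightarrow> prob_space (exponential_measure r)"
  unfolding exponential_measure_def by (rule prob_space_exponential_density)

lemma AE_exponential_measure_nonneg: "AE x in exponential_measure r. 0 \<le> x"
  unfolding exponential_measure_def by (subst AE_density) (auto simp: exponential_density_def)

text \<open>The ray is closed because a deadline \<open>t\<close> is met when \<open>t < w\<close>
  fails. It differs from the open ray of the usual tail formula by a null set.\<close>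

lemma emeasure_exponential_measure_ge:
  assumes r: "r > 0" and a: "a \<ge> 0"
  shows "emeasure (exponential_measure r) {a..} = ennreal (exp (- (r * a)))"
proof -
  interpret prob_space "exponential_measure r" by (rule prob_space_exponential_measure[OF r])
  have "distributed (exponential_measure r) lborel (\<lambda>x. x) (exponential_density r)"
    unfolding distributed_def
    by (auto simp: exponential_measure_def distr_id2 intro: exponential_density_nonneg[OF r])
  from exponential_distributedD_gt[OF this a r]
  have "prob {a<..} = exp (- (r * a))"
    by (simp add: greaterThan_def mult.commute)
  moreover have "AE x in exponential_measure r. x \<noteq> a"
    unfolding exponential_measure_def using AE_lborel_singleton[of a] by (subst AE_density) auto
  then have "emeasure (exponential_measure r) {a..} = emeasure (exponential_measure r) {a<..}"
    by (intro emeasure_eq_AE) auto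
  ultimately show ?thesis by (simp add: emeasure_eq_measure)
qed

text \<open>Multiplying the density of rate \<open>r\<close> by \<open>exp (- (u * x))\<close>
  yields a constant multiple of the density of rate \<open>r + u\<close>. For the service time, with
  \<open>u = \<theta>\<close>, this is the probability of finishing before an independent
  deadline.\<close>

lemma nn_integral_exp_exponential_measure:
  assumes "r > 0" "u > 0"
  shows "(\<integral>\<^sup>+x. ennreal (exp (- (u * x))) \<partial>exponential_measure r) = ennreal (r / (r + u))"
proof -
  have "(\<integral>\<^sup>+x. ennreal (exp (- (u * x))) \<partial>exponential_measure r)
      = (\<integral>\<^sup>+x. ennreal (exponential_density r x) * ennreal (exp (- (u * x))) \<partial>lborel)"
    unfolding exponential_measure_def by (subst nn_integral_density) auto
  also have "\<dots> = (\<integral>\<^sup>+x. ennreal (r / (r + u)) * ennreal (exponential_density (r + u) x) \<partial>lborel)"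
  proof (intro nn_integral_cong)
    fix x :: real
    have "exp (- (x * (r + u))) = exp (- (x * r)) * exp (- (u * x))"
      by (simp add: mult_exp_exp algebra_simps)
    then have "exponential_density r x * exp (- (u * x))
        = r / (r + u) * exponential_density (r + u) x"
      using assms by (simp add: exponential_density_def)
    then show "ennreal (exponential_density r x) * ennreal (exp (- (u * x)))
        = ennreal (r / (r + u)) * ennreal (exponential_density (r + u) x)"
      using assms by (simp add: ennreal_mult[symmetric] exponential_density_nonneg)
  qed
  also have "\<dots> = ennreal (r / (r + u)) * (\<integral>\<^sup>+x. ennreal (exponential_density (r + u) x) \<partial>lborel)"
    by (rule nn_integral_cmult) auto
  also have "(\<integral>\<^sup>+x. ennreal (exponential_density (r + u) x) \<partial>lborel) = 1"
    using prob_space.emeasure_space_1[OF prob_space_exponential_density[of "r + u"]] assms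
    by (simp add: emeasure_density)
  finally show ?thesis by simp
qed

text \<open>Integrate out the deadline first: for fixed \<open>y\<close> it must lie in
  \<open>{W y..}\<close>. Nonnegativity of \<open>W\<close> matters, since the tail formula fails
  below 0.\<close>

lemma emeasure_exponential_deadline_met:
  assumes r: "r > 0" and N: "prob_space N"
    and W [measurable]: "W \<in> borel_measurable N" and pos: "AE y in N. 0 \<le> W y"
  shows "emeasure (exponential_measure r \<Otimes>\<^sub>M N)
           {x \<in> space (exponential_measure r \<Otimes>\<^sub>M N). \<not> fst x < W (snd x)}
         = (\<integral>\<^sup>+y. ennreal (exp (- (r * W y))) \<partial>N)"
proof -
  interpret E: prob_space "exponential_measure r" by (rule prob_space_exponential_measure[OF r])
  interpret N: prob_space N by fact
  interpret pair_prob_space "exponential_measure r" N ..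
  let ?A = "{x \<in> space (exponential_measure r \<Otimes>\<^sub>M N). \<not> fst x < W (snd x)}"
  have "emeasure (exponential_measure r \<Otimes>\<^sub>M N) ?A
      = (\<integral>\<^sup>+y. emeasure (exponential_measure r) ((\<lambda>x. (x, y)) -` ?A) \<partial>N)"
    by (rule emeasure_pair_measure_alt2) measurable
  also have "\<dots> = (\<integral>\<^sup>+y. ennreal (exp (- (r * W y))) \<partial>N)"
  proof (rule nn_integral_cong_AE)
    show "AE y in N. emeasure (exponential_measure r) ((\<lambda>x. (x, y)) -` ?A)
            = ennreal (exp (- (r * W y)))"
      using pos AE_space
    proof eventually_elim
      case (elim y)
      then have "(\<lambda>x. (x, y)) -` ?A = {W y..}" by (auto simp: space_pair_measure)
      then show ?case using emeasure_exponential_measure_ge[OF r elim(1)] by simp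
    qed
  qed
  finally show ?thesis .
qed

section \<open>Fate of a job given the state it finds\<close>

text \<open>The wait and the job's own service time are independent, so the expected exponential
  factorises. \<open>C\<close> is the contribution of the service time, which is 1 under DBS because
  the deadline stops mattering once service starts.\<close>

lemma one_minus_abandonment_prob_given:
  fixes m i :: nat
  assumes mu: "\<mu> > 0" and th: "\<theta> > 0" and rates: "\<And>j. j \<in> {m..i} \<Longrightarrow> death_rate X m \<mu> \<theta> j > 0"
  defines "N \<equiv> \<Pi>\<^sub>M j\<in>{m..i}. exponential_measure (death_rate X m \<mu> \<theta> j)"
  defines "C \<equiv> (case X of DBS \<Rightarrow> 1 | DES \<Rightarrow> \<mu> / (\<mu> + \<theta>))"
  shows "ennreal (1 - abandonment_prob_given X m \<mu> \<theta> i)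
           = ennreal C * (\<integral>\<^sup>+e. ennreal (exp (- (\<theta> * offered_wait m i e))) \<partial>N)"
proof -
  let ?E = "exponential_measure \<mu>"
  \<comment> \<open>The time that the deadline has to outlast.\<close>
  define W :: "real \<times> (nat \<Rightarrow> real) \<Rightarrow> real" where
    "W = (\<lambda>(s, e). case X of DBS \<Rightarrow> offered_wait m i e | DES \<Rightarrow> offered_wait m i e + s)"
  interpret D: prob_space "exponential_measure \<theta>" by (rule prob_space_exponential_measure[OF th])
  interpret E: prob_space ?E by (rule prob_space_exponential_measure[OF mu])
  interpret N: prob_space N
    unfolding N_def using rates by (intro prob_space_PiM prob_space_exponential_measure)
  interpret EN: pair_prob_space ?E N ..
  interpret DEN: pair_prob_space "exponential_measure \<theta>" "?E \<Otimes>\<^sub>M N" ..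
  have [measurable]: "offered_wait m i \<in> borel_measurable N"
    unfolding offered_wait_def[abs_def] N_def by measurable
  have [measurable]: "W \<in> borel_measurable (?E \<Otimes>\<^sub>M N)"
    unfolding W_def by (cases X) simp_all
  \<comment> \<open>The exponential measures live on all reals, so nonnegativity holds only almost
    everywhere. For \<open>i < m\<close> the index set is empty and the wait is 0.\<close>
  have "AE e in N. \<forall>j\<in>{m..i}. 0 \<le> e j"
    unfolding N_def using rates
    by (intro AE_finite_allI AE_PiM_component prob_space_exponential_measure
        AE_exponential_measure_nonneg) auto
  then have wait_nonneg: "AE e in N. 0 \<le> offered_wait m i e"
    unfolding offered_wait_def by eventually_elim (auto intro: sum_nonneg)
  have W_nonneg: "AE y in ?E \<Otimes>\<^sub>M N. 0 \<le> W y"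
  proof (rule EN.AE_pair_measure)
    show "{x \<in> space (?E \<Otimes>\<^sub>M N). 0 \<le> W x} \<in> sets (?E \<Otimes>\<^sub>M N)" by measurable
    show "AE s in ?E. AE e in N. 0 \<le> W (s, e)"
      using AE_exponential_measure_nonneg
    proof eventually_elim
      case (elim s)
      from wait_nonneg show ?case
        by eventually_elim (use elim in \<open>auto simp: W_def split: deadline_type.split\<close>)
    qed
  qed
  have aband: "abandonment_prob_given X m \<mu> \<theta> i
      = DEN.prob {x \<in> space (exponential_measure \<theta> \<Otimes>\<^sub>M ?E \<Otimes>\<^sub>M N). fst x < W (snd x)}"
    unfolding abandonment_prob_given_def arrival_space_def N_def[symmetric]
    by (intro arg_cong[where f = DEN.prob]) (cases X; auto simp: W_def)
  have "1 - abandonment_prob_given X m \<mu> \<theta> i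
      = DEN.prob {x \<in> space (exponential_measure \<theta> \<Otimes>\<^sub>M ?E \<Otimes>\<^sub>M N). \<not> fst x < W (snd x)}"
    unfolding aband by (rule DEN.prob_neg[symmetric]) measurable
  then have "ennreal (1 - abandonment_prob_given X m \<mu> \<theta> i)
      = (\<integral>\<^sup>+y. ennreal (exp (- (\<theta> * W y))) \<partial>(?E \<Otimes>\<^sub>M N))"
    using emeasure_exponential_deadline_met[OF th EN.prob_space_axioms _ W_nonneg]
    by (simp add: DEN.emeasure_eq_measure)
  also have "\<dots> = (\<integral>\<^sup>+s. \<integral>\<^sup>+e. ennreal (exp (- (\<theta> * W (s, e)))) \<partial>N \<partial>?E)"
    by (rule N.nn_integral_fst[symmetric]) measurable
  also have "\<dots> = ennreal C * (\<integral>\<^sup>+e. ennreal (exp (- (\<theta> * offered_wait m i e))) \<partial>N)"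
  proof (cases X)
    case DBS
    then show ?thesis using E.emeasure_space_1 by (simp add: W_def C_def)
  next
    case DES
    \<comment> \<open>The exponential of the sum splits into a factor in \<open>s\<close> and a
      factor in \<open>e\<close>, which can then be integrated separately.\<close>
    have "(\<integral>\<^sup>+s. \<integral>\<^sup>+e. ennreal (exp (- (\<theta> * W (s, e)))) \<partial>N \<partial>?E)
        = (\<integral>\<^sup>+s. \<integral>\<^sup>+e. ennreal (exp (- (\<theta> * s))) * ennreal (exp (- (\<theta> * offered_wait m i e))) \<partial>N \<partial>?E)"
      by (intro nn_integral_cong)
        (simp add: W_def DES ennreal_mult[symmetric] exp_add[symmetric] algebra_simps)
    also have "\<dots> = (\<integral>\<^sup>+s. ennreal (exp (- (\<theta> * s))) \<partial>?E)
        * (\<integral>\<^sup>+e. ennreal (exp (- (\<theta> * offered_wait m i e))) \<partial>N)"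
      by (simp add: nn_integral_cmult nn_integral_multc)
    finally show ?thesis
      by (simp add: nn_integral_exp_exponential_measure mu th C_def DES)
  qed
  finally show ?thesis .
qed

text \<open>Needed to pass from \<open>ennreal\<close>, which sends negative reals to 0, back to
  real equations, and to bound the series over the states.\<close>

lemma abandonment_prob_given_bounds:
  assumes mu: "\<mu> > 0" and th: "\<theta> > 0" and rates: "\<And>j. j \<in> {m..i} \<Longrightarrow> death_rate X m \<mu> \<theta> j > 0"
  shows "abandonment_prob_given X m \<mu> \<theta> i \<in> {0..1}"
proof -
  interpret D: prob_space "exponential_measure \<theta>" by (rule prob_space_exponential_measure[OF th])
  interpret E: prob_space "exponential_measure \<mu>" by (rule prob_space_exponential_measure[OF mu])
  interpret N: prob_space "\<Pi>\<^sub>M j\<in>{m..i}. exponential_measure (death_rate X m \<mu> \<theta> j)"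
    using rates by (intro prob_space_PiM prob_space_exponential_measure)
  interpret EN: pair_prob_space "exponential_measure \<mu>"
    "\<Pi>\<^sub>M j\<in>{m..i}. exponential_measure (death_rate X m \<mu> \<theta> j)" ..
  interpret DEN: pair_prob_space "exponential_measure \<theta>" "exponential_measure \<mu> \<Otimes>\<^sub>M
    (\<Pi>\<^sub>M j\<in>{m..i}. exponential_measure (death_rate X m \<mu> \<theta> j))" ..
  show ?thesis
    unfolding abandonment_prob_given_def arrival_space_def by simp
qed

text \<open>Equal death rates give the two queues the same law of the offered wait, so the two
  chances of being served differ only in the factor \<open>C\<close>.\<close>

lemma abandonment_prob_given_DES:
  assumes mu: "\<mu> > 0" and th: "\<theta> > 0" and m: "m \<ge> 1"
  shows "(\<mu> + \<theta>) * (1 - abandonment_prob_given DES m \<mu> \<theta> i)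
           = \<mu> * (1 - abandonment_prob_given DBS m (\<mu> + \<theta>) \<theta> i)"
proof -
  \<comment> \<open>\<open>m \<ge> 1\<close> keeps state 0, whose death rate is 0, out of the
    product measure.\<close>
  have pos: "death_rate DES m \<mu> \<theta> j > 0" if "j \<in> {m..i}" for j
    unfolding death_rate_DES using that mu th m by (intro add_pos_pos mult_pos_pos) auto
  have b: "abandonment_prob_given DES m \<mu> \<theta> i \<in> {0..1}"
      "abandonment_prob_given DBS m (\<mu> + \<theta>) \<theta> i \<in> {0..1}"
    using mu th pos by (intro abandonment_prob_given_bounds; simp add: death_rate_DBS)+
  have "ennreal (1 - abandonment_prob_given DES m \<mu> \<theta> i)
      = ennreal (\<mu> / (\<mu> + \<theta>)) * ennreal (1 - abandonment_prob_given DBS m (\<mu> + \<theta>) \<theta> i)"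
    using one_minus_abandonment_prob_given[of \<mu> \<theta> m i DES]
      one_minus_abandonment_prob_given[of "\<mu> + \<theta>" \<theta> m i DBS] mu th pos
    by (simp add: death_rate_DBS)
  also have "\<dots> = ennreal (\<mu> / (\<mu> + \<theta>) * (1 - abandonment_prob_given DBS m (\<mu> + \<theta>) \<theta> i))"
    using b mu th by (intro ennreal_mult[symmetric]) auto
  finally have "1 - abandonment_prob_given DES m \<mu> \<theta> i
      = \<mu> / (\<mu> + \<theta>) * (1 - abandonment_prob_given DBS m (\<mu> + \<theta>) \<theta> i)"
    using b mu th by (subst (asm) ennreal_inj) auto
  then show ?thesis using mu th by (simp add: field_simps)
qed

section \<open>Averaging over the state found on arrival\<close>

lemma sums_one_minus_abandonment_prob:
  assumes mu: "\<mu> > 0" and th: "\<theta> > 0" and rates: "\<And>j. j \<ge> m \<Longrightarrow> death_rate X m \<mu> \<theta> j > 0"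
  shows "(\<lambda>i. pmf (steady_state X m \<mu> \<theta> lam) i * (1 - abandonment_prob_given X m \<mu> \<theta> i))
           sums (1 - abandonment_prob X m \<mu> \<theta> lam)"
proof -
  let ?p = "pmf (steady_state X m \<mu> \<theta> lam)"
  let ?a = "abandonment_prob_given X m \<mu> \<theta>"
  have "?a i \<in> {0..1}" for i
    using assms by (intro abandonment_prob_given_bounds) auto
  \<comment> \<open>Domination by the steady-state probabilities makes the series converge, so that
    the complement can be taken term by term.\<close>
  then have "summable (\<lambda>i. ?p i * ?a i)"
    by (intro summable_comparison_test'[OF sums_summable[OF sums_pmf_nat[of "steady_state X m \<mu> \<theta> lam"]]])
      (auto simp: abs_mult intro: mult_left_le)
  then have "(\<lambda>i. ?p i - ?p i * ?a i) sums (1 - (\<Sum>i. ?p i * ?a i))"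
    by (intro sums_diff sums_pmf_nat summable_sums)
  then show ?thesis by (simp add: abandonment_prob_def algebra_simps)
qed

lemma abandonment_prob_DES:
  assumes mu: "\<mu> > 0" and th: "\<theta> > 0" and m: "m \<ge> 1"
  shows "(\<mu> + \<theta>) * (1 - abandonment_prob DES m \<mu> \<theta> lam)
           = \<mu> * (1 - abandonment_prob DBS m (\<mu> + \<theta>) \<theta> lam)"
proof -
  let ?p = "pmf (steady_state DES m \<mu> \<theta> lam)"
  have pos: "death_rate DES m \<mu> \<theta> j > 0" if "j \<ge> m" for j
    unfolding death_rate_DES using that mu th m by (intro add_pos_pos mult_pos_pos) auto
  have "(\<lambda>i. (\<mu> + \<theta>) * (?p i * (1 - abandonment_prob_given DES m \<mu> \<theta> i)))
      sums ((\<mu> + \<theta>) * (1 - abandonment_prob DES m \<mu> \<theta> lam))"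
    using mu th pos by (intro sums_mult sums_one_minus_abandonment_prob)
  moreover have "(\<lambda>i. \<mu> * (?p i * (1 - abandonment_prob_given DBS m (\<mu> + \<theta>) \<theta> i)))
      sums (\<mu> * (1 - abandonment_prob DBS m (\<mu> + \<theta>) \<theta> lam))"
    \<comment> \<open>The DBS average is rewritten over the DES steady state, so that both series
      carry the same weights \<open>?p i\<close> and can be compared termwise.\<close>
    using sums_mult[OF sums_one_minus_abandonment_prob[of "\<mu> + \<theta>" \<theta> m DBS lam], of \<mu>] mu th pos
    by (simp add: death_rate_DBS steady_state_DBS)
  moreover have "(\<mu> + \<theta>) * (?p i * (1 - abandonment_prob_given DES m \<mu> \<theta> i))
      = \<mu> * (?p i * (1 - abandonment_prob_given DBS m (\<mu> + \<theta>) \<theta> i))" for i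
    using arg_cong[OF abandonment_prob_given_DES[OF assms, of i], of "(*) (?p i)"]
    by (simp only: mult.left_commute)
  ultimately show ?thesis by (simp only: sums_unique2)
qed

theorem proposition5:
  fixes lam \<mu> \<theta> :: real and m :: nat
  assumes "lam > 0" and "\<mu> > 0" and "\<theta> > 0" and "m \<ge> 1"
  shows "mean_busy_servers DES m \<mu> \<theta> lam = mean_busy_servers DBS m (\<mu> + \<theta>) \<theta> lam
    \<and> (\<mu> + \<theta>) * (1 - abandonment_prob DES m \<mu> \<theta> lam)
        = \<mu> * (1 - abandonment_prob DBS m (\<mu> + \<theta>) \<theta> lam)
    \<and> (\<mu> + \<theta>) * mean_abandonment_rate DES m \<mu> \<theta> lam
        = lam * \<theta> + \<mu> * mean_abandonment_rate DBS m (\<mu> + \<theta>) \<theta> lam"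
  using abandonment_prob_DES abandonment_rate_conservation assms
  by (simp add: mean_busy_servers_def steady_state_DBS)

end
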